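(* Let $\mathcal{H}$ be a complex Hilbert space and let $\mathtt{V}\subseteq\mathcal{H}$ be a standard subspace. Then $(\mathcal{H},\mathtt{V},J_{\mathtt{V}})$ is a maximal real reflection positive Hilbert space.
   Context: A standard subspace of a complex Hilbert space $\mathcal{H}$ is a closed real subspace $\mathtt{V}$ with $\mathtt{V}\cap i\mathtt{V}=\{0\}$ and $\overline{\mathtt{V}+i\mathtt{V}}=\mathcal{H}$. Its Tomita operator is the densely defined closed antilinear operator $T_{\mathtt{V}}:\mathtt{V}+i\mathtt{V}\to\mathcal{H}$, $x+iy\mapsto x-iy$ ($x,y\in\mathtt{V}$); $T_{\mathtt{V}}=J_{\mathtt{V}}\Delta_{\mathtt{V}}^{1/2}$ is its polar decomposition, with $J_{\mathtt{V}}$ an anti-unitary involution and $\Delta_{\mathtt{V}}$ a strictly positive self-adjoint operator. A real reflection positive Hilbert space is a triple $(\mathcal{E},\mathcal{E}_+,\theta)$ of a real Hilbert space $\mathcal{E}$, a closed real subspace $\mathcal{E}_+$ and an orthogonal involution $\theta$ on $\mathcal{E}$ with $\langle\xi,\theta\xi\rangle\ge0$ for all $\xi\in\mathcal{E}_+$. It is maximal if for every closed real subspace $\mathcal{E}_+'\supseteq\mathcal{E}_+$ the triple $(\mathcal{E},\mathcal{E}_+',\theta)$ is a reflection positive Hilbert space if and only if $\mathcal{E}_+'=\mathcal{E}_+$. Here $\mathcal{H}$ is regarded as a real Hilbert space with scalar product $\operatorname{Re}\langle\cdot,\cdot\rangle$. *)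

theory Defs
  imports "HOL-Analysis.Analysis"
begin

section \<open>Complex Hilbert spaces\<close>

text \<open>The complex scalar product is conjugate-linear in its first argument and linear in its second
  one. The inherited real inner product is its real part, so the class carries both the complex
  Hilbert space and the underlying real Hilbert space; positive definiteness, norm, topology and
  completeness come from \<^class>\<open>real_inner\<close> and \<^class>\<open>complete_space\<close>.\<close>

class complex_hilbert_space = real_inner + complete_space +
  fixes scaleC :: "complex \<Rightarrow> 'a \<Rightarrow> 'a" (infixr \<open>*\<^sub>C\<close> 75)
    and cinner :: "'a \<Rightarrow> 'a \<Rightarrow> complex"
  assumes scaleC_add_right: "c *\<^sub>C (x + y) = c *\<^sub>C x + c *\<^sub>C y"
    and scaleC_add_left: "(c + d) *\<^sub>C x = c *\<^sub>C x + d *\<^sub>C x"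
    and scaleC_scaleC: "c *\<^sub>C (d *\<^sub>C x) = (c * d) *\<^sub>C x"
    and scaleC_of_real: "complex_of_real r *\<^sub>C x = r *\<^sub>R x"
    and cinner_commute: "cinner x y = cnj (cinner y x)"
    and cinner_add_right: "cinner x (y + z) = cinner x y + cinner x z"
    and cinner_scaleC_right: "cinner x (c *\<^sub>C y) = c * cinner x y"
    and inner_eq_Re_cinner: "inner x y = Re (cinner x y)"

section \<open>Unbounded operators\<close>

text \<open>A partially defined operator is represented by its graph, so that equality of operators
  includes equality of domains; the domain is \<^term>\<open>Domain A\<close>, and \<^term>\<open>A O B\<close> is \<^term>\<open>A\<close>
  followed by \<^term>\<open>B\<close> on its natural domain.\<close>

type_synonym 'a operator = "('a \<times> 'a) set"

definition linear_operator :: "'a::complex_hilbert_space operator \<Rightarrow> bool" where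
  "linear_operator A \<longleftrightarrow>
     single_valued A \<and> (0, 0) \<in> A \<and>
     (\<forall>(x, y) \<in> A. \<forall>(x', y') \<in> A. (x + x', y + y') \<in> A) \<and>
     (\<forall>c. \<forall>(x, y) \<in> A. (c *\<^sub>C x, c *\<^sub>C y) \<in> A)"

definition densely_defined :: "'a::complex_hilbert_space operator \<Rightarrow> bool" where
  "densely_defined A \<longleftrightarrow> closure (Domain A) = UNIV"

definition adjoint_operator :: "'a::complex_hilbert_space operator \<Rightarrow> 'a operator" where
  "adjoint_operator A = {(y, z). \<forall>(x, w) \<in> A. cinner y w = cinner z x}"

definition self_adjoint :: "'a::complex_hilbert_space operator \<Rightarrow> bool" where
  "self_adjoint A \<longleftrightarrow> linear_operator A \<and> densely_defined A \<and> adjoint_operator A = A"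

definition positive_self_adjoint :: "'a::complex_hilbert_space operator \<Rightarrow> bool" where
  "positive_self_adjoint A \<longleftrightarrow> self_adjoint A \<and> (\<forall>(x, y) \<in> A. cinner x y \<in> \<real>\<^sub>\<ge>\<^sub>0)"

text \<open>Strict positivity means positivity with trivial kernel, not a positive lower bound.\<close>

definition strictly_positive_self_adjoint :: "'a::complex_hilbert_space operator \<Rightarrow> bool" where
  "strictly_positive_self_adjoint A \<longleftrightarrow> positive_self_adjoint A \<and> (\<forall>x. (x, 0) \<in> A \<longrightarrow> x = 0)"

definition is_sqrt_operator :: "'a::complex_hilbert_space operator \<Rightarrow> 'a operator \<Rightarrow> bool" where
  "is_sqrt_operator S A \<longleftrightarrow> positive_self_adjoint S \<and> S O S = A"

definition anti_unitary :: "('a::complex_hilbert_space \<Rightarrow> 'a) \<Rightarrow> bool" where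
  "anti_unitary J \<longleftrightarrow>
     (\<forall>x y. J (x + y) = J x + J y) \<and> (\<forall>c x. J (c *\<^sub>C x) = cnj c *\<^sub>C J x) \<and>
     surj J \<and> (\<forall>x y. cinner (J x) (J y) = cinner y x)"

section \<open>Standard subspaces\<close>

definition standard_subspace :: "'a::complex_hilbert_space set \<Rightarrow> bool" where
  "standard_subspace V \<longleftrightarrow>
     subspace V \<and> closed V \<and>
     V \<inter> (*\<^sub>C) \<i> ` V = {0} \<and>
     closure {x + \<i> *\<^sub>C y | x y. x \<in> V \<and> y \<in> V} = UNIV"

definition tomita_operator :: "'a::complex_hilbert_space set \<Rightarrow> 'a operator" where
  "tomita_operator V = {(x + \<i> *\<^sub>C y, x - \<i> *\<^sub>C y) | x y. x \<in> V \<and> y \<in> V}"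

text \<open>\<open>T = J \<Delta>\<^sup>1\<^sup>/\<^sup>2\<close>, where \<open>S\<close> stands for the square root of \<open>\<Delta>\<close>.\<close>

definition tomita_polar_decomposition ::
  "'a::complex_hilbert_space set \<Rightarrow> ('a \<Rightarrow> 'a) \<Rightarrow> 'a operator \<Rightarrow> bool" where
  "tomita_polar_decomposition V J \<Delta> \<longleftrightarrow>
     anti_unitary J \<and> (\<forall>x. J (J x) = x) \<and>
     strictly_positive_self_adjoint \<Delta> \<and>
     (\<exists>S. is_sqrt_operator S \<Delta> \<and> tomita_operator V = {(x, J y) | x y. (x, y) \<in> S})"

definition modular_conjugation :: "'a::complex_hilbert_space set \<Rightarrow> 'a \<Rightarrow> 'a" where
  "modular_conjugation V = (THE J. \<exists>\<Delta>. tomita_polar_decomposition V J \<Delta>)"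

section \<open>Real reflection positive Hilbert spaces\<close>

text \<open>The real Hilbert space is the whole type; in a complex Hilbert space \<^const>\<open>inner\<close> is the real
  part of the complex scalar product.\<close>

definition reflection_positive ::
  "'a::{real_inner, complete_space} set \<Rightarrow> ('a \<Rightarrow> 'a) \<Rightarrow> bool" where
  "reflection_positive E \<theta> \<longleftrightarrow>
     subspace E \<and> closed E \<and>
     orthogonal_transformation \<theta> \<and> (\<forall>x. \<theta> (\<theta> x) = x) \<and>
     (\<forall>\<xi> \<in> E. 0 \<le> inner \<xi> (\<theta> \<xi>))"

definition maximal_reflection_positive ::
  "'a::{real_inner, complete_space} set \<Rightarrow> ('a \<Rightarrow> 'a) \<Rightarrow> bool" where
  "maximal_reflection_positive E \<theta> \<longleftrightarrow>
     reflection_positive E \<theta> \<and>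
     (\<forall>E'. subspace E' \<and> closed E' \<and> E \<subseteq> E' \<longrightarrow> (reflection_positive E' \<theta> \<longleftrightarrow> E' = E))"

end

(* The bounded operator approach of Rieffel and van Daele. Let P and Q be the real orthogonal
   projections onto V and iV, and put D = P - Q, R = P + Q, C = 2 - R. Then D is antilinear and
   D^2 = R C; with B = (D^2)^(1/2) the polar decomposition D = J B yields the modular conjugation J,
   while Delta = C R^(-1) and Delta^(1/2) is the operator v |-> w with B w = C v.
   If J h = h and h is orthogonal to V, then 0 <= <h, B h> = <h, D h> = -|Q h|^2, so h = 0; hence every
   fixed point of J has the form v + J v with v in V. For x in a reflection positive subspace
   containing V, write x + J x = v + J v: then y = x - v satisfies J y = -y and 0 <= <y, J y>,
   so x = v. *)

theory Submission
  imports Defs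
begin

section \<open>Orthogonal projections\<close>

text \<open>The Tomita operator and \<Delta> may be unbounded, so no spectral calculus is applied to
  them. Each is a graph cut out by an equation between the bounded maps D, R, C and B, and all
  inverses stay formal. Two facts make this work. First, D, R, C and B are injective; the conditions
  on the intersection of V with iV and on the density of V + iV enter through the kernel of D, and
  the other kernels follow from it. Second, R + C = 2: this recovers z from R z and C z and splits
  any scalar product into two terms, in each of which an unbounded operator is exchanged for a
  bounded one. The root B is a strong limit of polynomials, which gives all its commutation
  relations at once. As the modular conjugation is a definite description, uniqueness of the polar
  decomposition is needed besides existence; it is reduced to uniqueness of the positive root of
  D^2. In the maximality argument the delicate point is that the vectors v + J v with v in V form a
  closed set, without which a fixed point of J could only be approximated by them.\<close>

lemma orthogonal_if_minimal:
  fixes a v :: "'a::real_inner"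
  assumes "\<And>t::real. (norm a)\<^sup>2 \<le> (norm (a - t *\<^sub>R v))\<^sup>2"
  shows "inner a v = 0"
proof (rule ccontr)
  assume n: "inner a v \<noteq> 0"
  define s where "s = inner v v"
  have s: "s > 0" using n unfolding s_def by (metis inner_gt_zero_iff inner_zero_right)
  \<comment> \<open>The chosen t minimises the quadratic polynomial in t on the right-hand
    side.\<close>
  have "(norm a)\<^sup>2 \<le> (norm (a - (inner a v / s) *\<^sub>R v))\<^sup>2" by (rule assms)
  also have "\<dots> = (norm a)\<^sup>2 - (inner a v)\<^sup>2 / s"
  proof -
    have "(norm (a - t *\<^sub>R v))\<^sup>2 = (norm a)\<^sup>2 - 2 * t * inner a v + t\<^sup>2 * s" for t
      unfolding s_def power2_norm_eq_inner
      by (simp add: inner_diff_left inner_diff_right inner_commute power2_eq_square algebra_simps)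
    from this[of "inner a v / s"] show ?thesis using s by (simp add: power2_eq_square field_simps)
  qed
  finally have "(inner a v)\<^sup>2 / s \<le> 0" by simp
  moreover have "(inner a v)\<^sup>2 / s > 0" using n s by simp
  ultimately show False by simp
qed

text \<open>A minimising sequence for the distance to x is Cauchy by the parallelogram law, because
  midpoints stay in V. Its limit is a nearest point, where the first variation vanishes.\<close>

lemma orthogonal_projection_exists:
  fixes V :: "'a::{real_inner,complete_space} set"
  assumes V: "subspace V" and cl: "closed V"
  shows "\<exists>p\<in>V. \<forall>v\<in>V. inner (x - p) v = 0"
proof -
  define f where "f v = (norm (x - v))\<^sup>2" for v
  define d where "d = (INF v\<in>V. f v)"
  have ne: "V \<noteq> {}" using V subspace_0 by auto
  have bdd: "bdd_below (f ` V)" by (rule bdd_belowI2[of _ 0]) (simp add: f_def)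
  have d_le: "d \<le> f v" if "v \<in> V" for v
    unfolding d_def using bdd that by (rule cINF_lower)
  have "\<exists>v\<in>V. f v < d + 1 / real (Suc n)" for n
    using cINF_less_iff[OF ne bdd, of "d + 1 / real (Suc n)"] by (simp add: d_def)
  then obtain u where uV: "\<And>n. u n \<in> V" and u: "\<And>n. f (u n) < d + 1 / real (Suc n)" by metis
  have par: "(norm (u n - u m))\<^sup>2 \<le> 2 / real (Suc n) + 2 / real (Suc m)" for n m
  proof -
    have "(1/2) *\<^sub>R (u n + u m) \<in> V" using V uV by (simp add: subspace_add subspace_scale)
    then have "d \<le> f ((1/2) *\<^sub>R (u n + u m))" by (rule d_le)
    moreover have "(norm (u n - u m))\<^sup>2 = 2 * f (u n) + 2 * f (u m) - 4 * f ((1/2) *\<^sub>R (u n + u m))"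
      unfolding f_def power2_norm_eq_inner
      by (simp add: inner_diff_left inner_diff_right inner_add_left inner_add_right inner_commute
          algebra_simps)
    ultimately show ?thesis using u[of n] u[of m] by simp
  qed
  have "Cauchy u"
  proof (rule metric_CauchyI)
    fix e :: real assume e: "e > 0"
    \<comment> \<open>This makes each of the two terms of \<open>par\<close> smaller than half of
      e^2.\<close>
    obtain N :: nat where N: "4 / e\<^sup>2 < real N" using reals_Archimedean2 by blast
    have "dist (u m) (u n) < e" if "m \<ge> N" "n \<ge> N" for m n
    proof -
      have "2 / real (Suc k) < e\<^sup>2 / 2" if "k \<ge> N" for k
      proof -
        have "4 / e\<^sup>2 < real (Suc k)" using N that by linarith
        then show ?thesis using e by (simp add: field_simps del: of_nat_Suc)
      qed
      then have "(norm (u m - u n))\<^sup>2 < e\<^sup>2" using par[of m n] that by (smt (verit) field_sum_of_halves)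
      then show ?thesis using e by (simp add: dist_norm power2_less_imp_less)
    qed
    then show "\<exists>M. \<forall>m\<ge>M. \<forall>n\<ge>M. dist (u m) (u n) < e" by blast
  qed
  then obtain p where p: "u \<longlonglongrightarrow> p" using Cauchy_convergent convergent_def by blast
  have pV: "p \<in> V" using cl uV p closed_sequentially by blast
  have "f p \<le> d"
  proof (rule LIMSEQ_le)
    show "(\<lambda>n. f (u n)) \<longlonglongrightarrow> f p" unfolding f_def by (intro tendsto_intros p)
    show "(\<lambda>n. d + 1 / real (Suc n)) \<longlonglongrightarrow> d"
      using tendsto_add[OF tendsto_const LIMSEQ_inverse_real_of_nat, of d] by (simp add: inverse_eq_divide)
    show "\<exists>N. \<forall>n\<ge>N. f (u n) \<le> d + 1 / real (Suc n)" using u less_imp_le by blast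
  qed
  have "inner (x - p) v = 0" if v: "v \<in> V" for v
  proof (rule orthogonal_if_minimal)
    fix t :: real
    have "p + t *\<^sub>R v \<in> V" using V pV v by (simp add: subspace_add subspace_scale)
    then have "f p \<le> f (p + t *\<^sub>R v)" using \<open>f p \<le> d\<close> d_le by force
    then show "(norm (x - p))\<^sup>2 \<le> (norm (x - p - t *\<^sub>R v))\<^sup>2" by (simp add: f_def diff_diff_add)
  qed
  then show ?thesis using pV by blast
qed

definition orth_proj :: "'a::{real_inner,complete_space} set \<Rightarrow> 'a \<Rightarrow> 'a" where
  "orth_proj V x = (SOME p. p \<in> V \<and> (\<forall>v\<in>V. inner (x - p) v = 0))"

context
  fixes V :: "'a::{real_inner,complete_space} set"
  assumes V: "subspace V" "closed V"
begin

lemma orth_proj_in: "orth_proj V x \<in> V"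
  and orth_proj_orthogonal: "v \<in> V \<Longrightarrow> inner (x - orth_proj V x) v = 0"
  using someI_ex[OF orthogonal_projection_exists[OF V, of x, unfolded Bex_def]]
  unfolding orth_proj_def by auto

lemma orth_proj_eqI:
  assumes "p \<in> V" "\<And>v. v \<in> V \<Longrightarrow> inner (x - p) v = 0"
  shows "orth_proj V x = p"
proof -
  let ?w = "orth_proj V x - p"
  have "?w \<in> V" using assms(1) orth_proj_in V by (simp add: subspace_diff)
  then have "inner (x - p) ?w - inner (x - orth_proj V x) ?w = 0"
    using assms(2) orth_proj_orthogonal by simp
  then have "inner ?w ?w = 0" by (simp add: inner_diff_left)
  then show ?thesis by simp
qed

lemma orth_proj_idem: "v \<in> V \<Longrightarrow> orth_proj V v = v"
  by (rule orth_proj_eqI) auto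

lemma linear_orth_proj: "linear (orth_proj V)"
proof (rule linearI)
  show "orth_proj V (x + y) = orth_proj V x + orth_proj V y" for x y
  proof (rule orth_proj_eqI)
    show "orth_proj V x + orth_proj V y \<in> V" using V orth_proj_in by (simp add: subspace_add)
    fix v assume v: "v \<in> V"
    then have "inner (x - orth_proj V x) v + inner (y - orth_proj V y) v = 0"
      by (simp only: orth_proj_orthogonal)
    then show "inner (x + y - (orth_proj V x + orth_proj V y)) v = 0"
      by (simp add: inner_diff_left inner_add_left)
  qed
  show "orth_proj V (c *\<^sub>R x) = c *\<^sub>R orth_proj V x" for c x
  proof (rule orth_proj_eqI)
    show "c *\<^sub>R orth_proj V x \<in> V" using V orth_proj_in by (simp add: subspace_scale)
    fix v assume v: "v \<in> V"
    then have "c * inner (x - orth_proj V x) v = 0" by (simp only: orth_proj_orthogonal)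
    then show "inner (c *\<^sub>R x - c *\<^sub>R orth_proj V x) v = 0" 
      by (simp add: inner_diff_left algebra_simps)
  qed
qed

lemma orth_proj_sym: "inner (orth_proj V x) y = inner x (orth_proj V y)"
  using orth_proj_orthogonal[OF orth_proj_in, of x y] orth_proj_orthogonal[OF orth_proj_in, of y x]
    inner_commute[of "orth_proj V x" y] inner_commute[of "orth_proj V x" "orth_proj V y"]
  by (simp add: inner_diff_left)

end

section \<open>Square roots of positive contractions\<close>

text \<open>The scalar case X = 1 of the operator iteration \<open>sqrt_iter\<close>. It majorises
  the norms of the iterates and of their differences, so its convergence yields theirs.\<close>

primrec sqrt_bound :: "nat \<Rightarrow> real" where
  "sqrt_bound 0 = 0"
| "sqrt_bound (Suc n) = (1 + (sqrt_bound n)\<^sup>2) / 2"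

lemma sqrt_bound_bounds: "0 \<le> sqrt_bound n \<and> sqrt_bound n \<le> 1"
  by (induction n) (auto simp: power_le_one)

lemma sqrt_bound_mono: "sqrt_bound n \<le> sqrt_bound (Suc n)"
proof -
  have "0 \<le> (1 - sqrt_bound n)\<^sup>2" by simp
  then show ?thesis by (simp add: power2_eq_square algebra_simps)
qed

lemma Cauchy_sqrt_bound: "Cauchy sqrt_bound"
proof -
  have "Bseq sqrt_bound" by (rule BseqI'[of _ 1]) (use sqrt_bound_bounds in auto)
  moreover have "monoseq sqrt_bound" using sqrt_bound_mono by (simp add: monoseq_Suc)
  ultimately show ?thesis using Bseq_monoseq_convergent convergent_Cauchy by blast
qed

primrec sqrt_iter :: "('a \<Rightarrow> 'a) \<Rightarrow> nat \<Rightarrow> 'a::real_vector \<Rightarrow> 'a" where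
  "sqrt_iter X 0 = (\<lambda>x. 0)"
| "sqrt_iter X (Suc n) = (\<lambda>x. (1/2) *\<^sub>R (X x + sqrt_iter X n (sqrt_iter X n x)))"

text \<open>The limit \<open>Y\<close> of the iteration for \<open>X = 1 - A\<close> satisfies \<open>2Y = X + Y\<^sup>2\<close>, that is \<open>(1 - Y)\<^sup>2 = A\<close>.\<close>

definition op_sqrt :: "('a \<Rightarrow> 'a) \<Rightarrow> 'a::real_normed_vector \<Rightarrow> 'a" where
  "op_sqrt A x = x - lim (\<lambda>n. sqrt_iter (\<lambda>z. z - A z) n x)"

text \<open>The last assumption says \<open>A\<^sup>2 \<le> A\<close>, that is \<open>0 \<le> A \<le> 1\<close>.\<close>

locale positive_contraction =
  fixes A :: "'a::{real_inner,complete_space} \<Rightarrow> 'a"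
  assumes linear_A: "linear A"
    and sym_A: "inner (A x) y = inner x (A y)"
    and square_le_A: "(norm (A x))\<^sup>2 \<le> inner x (A x)"
begin

definition X where "X x = x - A x"

abbreviation Y where "Y \<equiv> sqrt_iter X"

lemma norm_X_le: "norm (X x) \<le> norm x"
proof (rule power2_le_imp_le)
  have "(norm (X x))\<^sup>2 = (norm x)\<^sup>2 - 2 * inner x (A x) + (norm (A x))\<^sup>2"
    by (simp add: X_def power2_norm_eq_inner inner_diff_left inner_diff_right inner_commute)
  also have "\<dots> \<le> (norm x)\<^sup>2" using square_le_A[of x] zero_le_power2[of "norm (A x)"] by linarith
  finally show "(norm (X x))\<^sup>2 \<le> (norm x)\<^sup>2" .
qed simp

lemma linear_X: "linear X"
  unfolding X_def by (intro linear_compose_sub linear_A linear_ident)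

lemma linear_Y: "linear (Y n)"
proof (induction n)
  case 0
  show ?case by (simp add: module_hom_zero)
next
  case (Suc n)
  have "linear (\<lambda>x. Y n (Y n x))" using linear_compose[OF Suc Suc] by (simp add: o_def)
  then show ?case by (simp add: linear_compose_scale_right linear_compose_add linear_X)
qed

text \<open>Each iterate is a polynomial in \<open>X\<close>.\<close>

lemma Y_commute:
  assumes "linear F" "\<And>x. F (X x) = X (F x)"
  shows "F (Y n x) = Y n (F x)"
  using assms by (induction n arbitrary: x) (auto simp: linear_0 linear_add linear_scale)

lemma Y_Y_commute: "Y m (Y n x) = Y n (Y m x)"
  by (metis Y_commute linear_X linear_Y)

lemma norm_Y_le: "norm (Y n x) \<le> sqrt_bound n * norm x"
proof (induction n arbitrary: x)
  case (Suc n)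
  have "norm (Y n (Y n x)) \<le> sqrt_bound n * (sqrt_bound n * norm x)"
    by (rule order_trans[OF Suc]) (use Suc[of x] sqrt_bound_bounds in \<open>simp add: mult_left_mono\<close>)
  then have "norm (X x + Y n (Y n x)) \<le> norm x + sqrt_bound n * (sqrt_bound n * norm x)"
    using norm_X_le[of x] norm_triangle_ineq[of "X x" "Y n (Y n x)"] by linarith
  then show ?case
    by (simp add: power2_eq_square distrib_right del: scaleR_right_distrib)
qed simp

text \<open>The iterates commute, so the difference of the squares of \<open>Y (Suc n)\<close> and
  \<open>Y n\<close> factors into difference times sum. The scalar iteration obeys the same
  recursion with equality, and the induction compares the two.\<close>

lemma norm_Y_diff_Suc: "norm (Y (Suc n) x - Y n x) \<le> (sqrt_bound (Suc n) - sqrt_bound n) * norm x"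
proof (induction n arbitrary: x)
  case 0
  show ?case using norm_X_le[of x] by simp
next
  case (Suc n)
  define a b where ab: "a = sqrt_bound (Suc n)" "b = sqrt_bound n"
  have ab0: "0 \<le> a - b" "0 \<le> a" "0 \<le> b" using sqrt_bound_mono sqrt_bound_bounds unfolding ab by auto
  define z where "z = Y (Suc n) x + Y n x"
  have Y_Suc: "Y (Suc k) x = (1/2) *\<^sub>R (X x + Y k (Y k x))" for k by simp
  have "Y (Suc (Suc n)) x - Y (Suc n) x = (1/2) *\<^sub>R (Y (Suc n) (Y (Suc n) x) - Y n (Y n x))"
    using Y_Suc[of "Suc n"] Y_Suc[of n]
    by (simp only: scaleR_right_diff_distrib[symmetric] add_diff_cancel_left)
  also have "Y (Suc n) (Y (Suc n) x) - Y n (Y n x) = Y (Suc n) z - Y n z"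
    unfolding z_def linear_add[OF linear_Y] using Y_Y_commute[of n "Suc n" x] by (simp del: sqrt_iter.simps)
  finally have "norm (Y (Suc (Suc n)) x - Y (Suc n) x) = norm (Y (Suc n) z - Y n z) / 2"
    by simp
  also have "norm (Y (Suc n) z - Y n z) \<le> (a - b) * norm z"
    using Suc unfolding ab .
  also have "\<dots> \<le> (a - b) * ((a + b) * norm x)"
  proof (rule mult_left_mono[OF _ ab0(1)])
    show "norm z \<le> (a + b) * norm x"
      unfolding z_def using norm_triangle_ineq[of "Y (Suc n) x" "Y n x"] norm_Y_le[of "Suc n" x] norm_Y_le[of n x]
      unfolding ab distrib_right by linarith
  qed
  finally have "norm (Y (Suc (Suc n)) x - Y (Suc n) x) \<le> (a - b) * (a + b) / 2 * norm x"
    by (simp add: mult.assoc del: sqrt_iter.simps)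
  also have "(a - b) * (a + b) / 2 = (1 + a\<^sup>2) / 2 - (1 + b\<^sup>2) / 2"
    by (simp add: power2_eq_square algebra_simps diff_divide_distrib add_divide_distrib)
  finally show ?case by (simp only: ab sqrt_bound.simps(2))
qed

lemma norm_Y_diff:
  assumes "m \<le> n"
  shows "norm (Y n x - Y m x) \<le> (sqrt_bound n - sqrt_bound m) * norm x"
  using assms
proof (induction n rule: dec_induct)
  case (step n)
  have "norm (Y (Suc n) x - Y m x) \<le> norm (Y (Suc n) x - Y n x) + norm (Y n x - Y m x)"
    using norm_triangle_ineq[of "Y (Suc n) x - Y n x" "Y n x - Y m x"] by (simp del: sqrt_iter.simps)
  then show ?case using step(3) norm_Y_diff_Suc[of n x] unfolding left_diff_distrib by linarith
qed simp

lemma Cauchy_Y: "Cauchy (\<lambda>n. Y n x)"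
proof (rule metric_CauchyI)
  fix e :: real assume e: "e > 0"
  \<comment> \<open>The added 1 keeps the denominator positive when x = 0.\<close>
  define k where "k = e / (norm x + 1)"
  have k: "k > 0" using e by (simp add: k_def add_nonneg_pos)
  obtain M where M: "\<And>m n. m \<ge> M \<Longrightarrow> n \<ge> M \<Longrightarrow> dist (sqrt_bound m) (sqrt_bound n) < k"
    using Cauchy_sqrt_bound k unfolding Cauchy_def by blast
  have less: "dist (Y m x) (Y n x) < e" if "M \<le> n" "n \<le> m" for m n
  proof -
    have "dist (Y m x) (Y n x) \<le> (sqrt_bound m - sqrt_bound n) * norm x"
      unfolding dist_norm by (rule norm_Y_diff) fact
    also have "\<dots> \<le> k * norm x"
      using M[of m n] that by (intro mult_right_mono) (auto simp: dist_norm)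
    also have "\<dots> < k * (norm x + 1)" using k by simp
    also have "\<dots> = e" by (simp add: k_def add_nonneg_eq_0_iff)
    finally show ?thesis .
  qed
  have "dist (Y m x) (Y n x) < e" if "m \<ge> M" "n \<ge> M" for m n
    using less[of m n] less[of n m] that by (metis dist_commute nat_le_linear)
  then show "\<exists>M. \<forall>m\<ge>M. \<forall>n\<ge>M. dist (Y m x) (Y n x) < e" by blast
qed

definition Z where "Z x = lim (\<lambda>n. Y n x)"

lemma Y_tendsto: "(\<lambda>n. Y n x) \<longlonglongrightarrow> Z x"
  unfolding Z_def using Cauchy_Y Cauchy_convergent convergent_LIMSEQ_iff by blast

lemma op_sqrt_eq: "op_sqrt A x = x - Z x"
  unfolding op_sqrt_def Z_def X_def[abs_def] by simp

lemma linear_Z: "linear Z"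
proof (rule linearI)
  show "Z (x + y) = Z x + Z y" for x y
    using tendsto_add[OF Y_tendsto[of x] Y_tendsto[of y]] Y_tendsto[of "x + y"]
    by (simp add: linear_add[OF linear_Y] LIMSEQ_unique)
  show "Z (c *\<^sub>R x) = c *\<^sub>R Z x" for c x
    using tendsto_scaleR[OF tendsto_const Y_tendsto[of x], of c] Y_tendsto[of "c *\<^sub>R x"]
    by (simp add: linear_scale[OF linear_Y] LIMSEQ_unique)
qed

lemma norm_Y_le1: "norm (Y n x) \<le> norm x"
  using norm_Y_le[of n x] sqrt_bound_bounds[of n] mult_right_mono[of "sqrt_bound n" 1 "norm x"] by simp

lemma norm_Z_le: "norm (Z x) \<le> norm x"
  by (rule LIMSEQ_le_const2[OF tendsto_norm[OF Y_tendsto]]) (use norm_Y_le1 in auto)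

lemma Z_eq: "Z x + Z x = X x + Z (Z x)"
proof -
  \<comment> \<open>In \<open>Y n (Y n x)\<close> operator and argument both vary with n. As all
    \<open>Y n\<close> are contractions, the argument may be replaced by its limit
    \<open>Z x\<close> first.\<close>
  have "(\<lambda>n. Y n (Y n x - Z x)) \<longlonglongrightarrow> 0"
  proof (rule Lim_null_comparison)
    show "\<forall>\<^sub>F n in sequentially. norm (Y n (Y n x - Z x)) \<le> norm (Y n x - Z x)"
      using norm_Y_le1 by simp
    show "(\<lambda>n. norm (Y n x - Z x)) \<longlonglongrightarrow> 0"
      using Y_tendsto[of x] LIM_zero tendsto_norm_zero by blast
  qed
  then have "(\<lambda>n. Y n (Y n x - Z x) + Y n (Z x)) \<longlonglongrightarrow> 0 + Z (Z x)"
    by (intro tendsto_add Y_tendsto)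
  then have "(\<lambda>n. Y n (Y n x)) \<longlonglongrightarrow> Z (Z x)" by (simp add: linear_diff[OF linear_Y])
  then have "(\<lambda>n. Y (Suc n) x) \<longlonglongrightarrow> (1/2) *\<^sub>R (X x + Z (Z x))"
    unfolding sqrt_iter.simps by (intro tendsto_intros)
  then have "Z x = (1/2) *\<^sub>R (X x + Z (Z x))"
    using Y_tendsto[of x] LIMSEQ_Suc LIMSEQ_unique by blast
  then have "2 *\<^sub>R Z x = 2 *\<^sub>R ((1/2) *\<^sub>R (X x + Z (Z x)))" by metis
  then show ?thesis by (simp add: scaleR_2)
qed

lemma Y_sym: "inner (Y n x) y = inner x (Y n y)"
  by (induction n arbitrary: x y) (auto simp: inner_add_left inner_add_right inner_diff_left inner_diff_right X_def sym_A)

lemma Z_sym: "inner (Z x) y = inner x (Z y)"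
  using tendsto_inner[OF Y_tendsto[of x] tendsto_const, of y] tendsto_inner[OF tendsto_const Y_tendsto[of y], of x]
  by (simp add: Y_sym LIMSEQ_unique)

abbreviation B where "B \<equiv> op_sqrt A"

lemma op_sqrt_linear: "linear B"
  unfolding op_sqrt_eq[abs_def] by (intro linear_compose_sub linear_Z linear_ident)

lemma op_sqrt_sym: "inner (B x) y = inner x (B y)"
  by (simp add: op_sqrt_eq inner_diff_left inner_diff_right Z_sym)

lemma op_sqrt_nonneg: "0 \<le> inner x (B x)"
proof -
  have "inner x (Z x) \<le> norm x * norm x"
    by (meson norm_Z_le mult_left_mono norm_cauchy_schwarz norm_ge_zero order_trans)
  then show ?thesis by (simp add: op_sqrt_eq inner_diff_right dot_square_norm power2_eq_square)
qed

lemma op_sqrt_square: "B (B x) = A x"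
proof -
  have "B (B x) = x - (Z x + Z x) + Z (Z x)" by (simp add: op_sqrt_eq linear_diff[OF linear_Z])
  then show ?thesis unfolding Z_eq by (simp add: X_def)
qed

text \<open>Commutation passes from the polynomials \<open>Y n\<close> to their strong limit;
  boundedness of F lets F be moved through that limit.\<close>

lemma op_sqrt_commute:
  assumes F: "bounded_linear F" and c: "\<And>x. F (A x) = A (F x)"
  shows "F (B x) = B (F x)"
proof -
  have lin: "linear F" using F by (simp add: bounded_linear.linear)
  have "F (X z) = X (F z)" for z using c lin by (simp add: X_def linear_diff)
  then have "F (Y n x) = Y n (F x)" for n using lin Y_commute by blast
  then have "(\<lambda>n. Y n (F x)) \<longlonglongrightarrow> F (Z x)"
    using bounded_linear.tendsto[OF F Y_tendsto[of x]] by simp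
  then have "F (Z x) = Z (F x)" using Y_tendsto LIMSEQ_unique by blast
  then show ?thesis by (simp add: op_sqrt_eq linear_diff[OF lin])
qed

lemma op_sqrt_bounded: "bounded_linear B"
proof (rule bounded_linear_intro[where K = 2])
  show "norm (B x) \<le> norm x * 2" for x
    unfolding op_sqrt_eq using norm_triangle_ineq4[of x "Z x"] norm_Z_le[of x] by linarith
qed (use op_sqrt_linear in \<open>auto simp: linear_add linear_scale\<close>)

end

text \<open>A zero of a nonnegative quadratic form is a minimum, so moving from y in the direction
  of \<open>- L y\<close> cannot decrease the form.\<close>

lemma positive_form_kernel:
  fixes L :: "'a::real_inner \<Rightarrow> 'a"
  assumes lin: "linear L" and sym: "\<And>x y. inner (L x) y = inner x (L y)"
    and pos: "\<And>x. 0 \<le> inner x (L x)" and y: "inner y (L y) = 0"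
  shows "L y = 0"
proof (rule ccontr)
  assume "L y \<noteq> 0"
  define n where "n = inner (L y) (L y)"
  define c where "c = inner (L y) (L (L y))"
  \<comment> \<open>Small enough that the quadratic term t^2 c stays below the linear term 2 t n;
    the added 1 covers c = 0.\<close>
  define t where "t = n / (c + 1)"
  have n: "n > 0" unfolding n_def using \<open>L y \<noteq> 0\<close> by simp
  have c: "c \<ge> 0" unfolding c_def by (rule pos)
  have t: "t > 0" unfolding t_def using n c by simp
  have "inner (y - t *\<^sub>R L y) (L (y - t *\<^sub>R L y)) = t * (t * c - 2 * n)"
    using sym[of y "L y"] y by (simp add: linear_diff[OF lin] linear_scale[OF lin] inner_diff_left inner_diff_right
        inner_commute n_def c_def algebra_simps)
  then have "0 \<le> t * (t * c - 2 * n)" using pos by metis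
  then have "2 * n \<le> t * c" using t by (simp add: zero_le_mult_iff)
  moreover have "t * c < n" unfolding t_def using n c by (simp add: field_simps)
  ultimately show False using n by linarith
qed

text \<open>L commutes with A = L^2, hence with B, so (B + L)(B - L) = B^2 - L^2 = 0. With y = B x -
  L x, positivity of both forms splits (B + L) y = 0 into B y = L y = 0, and then the square of the
  norm of y is the scalar product of x with (B - L) y, which is 0.\<close>

lemma (in positive_contraction) op_sqrt_unique:
  assumes lin: "linear L" and sym: "\<And>x y. inner (L x) y = inner x (L y)"
    and pos: "\<And>x. 0 \<le> inner x (L x)" and sq: "\<And>x. L (L x) = A x"
  shows "L x = B x"
proof -
  \<comment> \<open>The upper bound A \<le> 1 makes L a contraction, so that
    \<open>op_sqrt_commute\<close> applies to it.\<close>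
  have A_le: "inner z (A z) \<le> (norm z)\<^sup>2" for z
  proof -
    have "0 \<le> (norm (z - A z))\<^sup>2" by simp
    also have "\<dots> = (norm z)\<^sup>2 - 2 * inner z (A z) + (norm (A z))\<^sup>2"
      by (simp add: power2_norm_eq_inner inner_diff_left inner_diff_right inner_commute)
    finally show ?thesis using square_le_A[of z] by linarith
  qed
  have bdd: "bounded_linear L"
  proof (rule bounded_linear_intro[where K = 1])
    show "norm (L z) \<le> norm z * 1" for z
    proof (rule power2_le_imp_le)
      have "(norm (L z))\<^sup>2 = inner z (A z)" by (simp add: power2_norm_eq_inner sym sq)
      then show "(norm (L z))\<^sup>2 \<le> (norm z * 1)\<^sup>2" using A_le by simp
    qed simp
  qed (use lin in \<open>auto simp: linear_add linear_scale\<close>)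
  have comm: "L (B z) = B (L z)" for z
    by (rule op_sqrt_commute[OF bdd]) (simp flip: sq)
  define y where "y = B x - L x"
  have sum0: "B y + L y = 0"
    unfolding y_def by (simp add: linear_diff[OF lin] linear_diff[OF op_sqrt_linear] comm sq op_sqrt_square)
  have "inner y (B y) + inner y (L y) = 0" using sum0 by (metis inner_add_right inner_zero_right)
  then have "inner y (B y) = 0" "inner y (L y) = 0" using pos[of y] op_sqrt_nonneg[of y] by linarith+
  then have "B y = 0" "L y = 0"
    using positive_form_kernel[OF lin sym pos] positive_form_kernel[OF op_sqrt_linear op_sqrt_sym op_sqrt_nonneg]
    by blast+
  moreover have "inner y y = inner x (B y) - inner x (L y)"
    by (subst (1) y_def) (simp add: inner_diff_left op_sqrt_sym sym)
  ultimately show ?thesis by (simp add: y_def)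
qed

section \<open>Dense subspaces and isometric extension\<close>

lemma subspace_closure:
  fixes U :: "'a::real_normed_vector set"
  assumes "subspace U"
  shows "subspace (closure U)"
proof (rule subspaceI)
  show "0 \<in> closure U" using assms closure_subset subspace_0 by blast
  show "x + y \<in> closure U" if xy: "x \<in> closure U" "y \<in> closure U" for x y
  proof -
    obtain a b where "\<forall>n. a n \<in> U" "a \<longlonglongrightarrow> x" "\<forall>n. b n \<in> U" "b \<longlonglongrightarrow> y"
      using xy unfolding closure_sequential by blast
    then show ?thesis unfolding closure_sequential using assms
      by (intro exI[of _ "\<lambda>n. a n + b n"]) (auto intro: tendsto_add subspace_add)
  qed
  show "c *\<^sub>R x \<in> closure U" if x: "x \<in> closure U" for c x
  proof -
    obtain a where "\<forall>n. a n \<in> U" "a \<longlonglongrightarrow> x" using x unfolding closure_sequential by blast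
    then show ?thesis unfolding closure_sequential using assms
      by (intro exI[of _ "\<lambda>n. c *\<^sub>R a n"]) (auto intro: tendsto_scaleR subspace_scale)
  qed
qed

lemma dense_subspaceI:
  fixes U :: "'a::{real_inner,complete_space} set"
  assumes U: "subspace U" and orth: "\<And>x. (\<And>u. u \<in> U \<Longrightarrow> inner x u = 0) \<Longrightarrow> x = 0"
  shows "closure U = UNIV"
proof -
  have "x \<in> closure U" for x
  proof -
    obtain p where p: "p \<in> closure U" "\<forall>v\<in>closure U. inner (x - p) v = 0"
      using orthogonal_projection_exists[OF subspace_closure[OF U] closed_closure] by blast
    then have "x - p = 0" using orth closure_subset by blast
    then show ?thesis using p by simp
  qed
  then show ?thesis by blast
qed

lemma continuous_eq_on_dense:
  fixes f g :: "'a::topological_space \<Rightarrow> 'b::t2_space"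
  assumes "continuous_on UNIV f" "continuous_on UNIV g" "closure U = UNIV" "\<And>x. x \<in> U \<Longrightarrow> f x = g x"
  shows "f x = g x"
  using closure_minimal[OF _ closed_Collect_eq[OF assms(1,2)], of U] assms(3,4) by auto

lemma orthogonal_to_dense:
  fixes x :: "'a::real_inner"
  assumes "closure U = UNIV" "\<And>u. u \<in> U \<Longrightarrow> inner x u = 0"
  shows "x = 0"
proof -
  have "inner x x = 0"
    by (rule continuous_eq_on_dense[where f = "inner x" and g = "\<lambda>_. 0", OF _ _ assms])
      (intro continuous_intros)+
  then show ?thesis by simp
qed

text \<open>The orthogonal complement of the range of a symmetric operator is its kernel.\<close>

lemma symmetric_dense_range:
  fixes L :: "'a::{real_inner,complete_space} \<Rightarrow> 'a"
  assumes "linear L" "\<And>x y. inner (L x) y = inner x (L y)" "\<And>x. L x = 0 \<Longrightarrow> x = 0"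
  shows "closure (range L) = UNIV"
proof (rule dense_subspaceI)
  show "subspace (range L)" by (rule linear_subspace_image[OF assms(1) subspace_UNIV])
  fix x assume "\<And>u. u \<in> range L \<Longrightarrow> inner x u = 0"
  then have "inner (L x) (L x) = 0" by (simp add: assms(2))
  then show "x = 0" using assms(3) by simp
qed

lemma bounded_linear_isometry:
  assumes "linear f" "\<And>x. norm (f x) = norm x"
  shows "bounded_linear f"
  by (rule bounded_linear_intro[where K = 1]) (use assms in \<open>auto simp: linear_add linear_scale\<close>)

text \<open>The isometric factor of a polar decomposition: sending B z to D z preserves norms on the
  range of B, hence is uniformly continuous there and extends to the closure.\<close>

lemma isometric_extension:
  fixes B :: "'a::real_vector \<Rightarrow> 'b::real_normed_vector" and D :: "'a \<Rightarrow> 'c::{real_normed_vector,complete_space}"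
  assumes B: "linear B" and D: "linear D" and eq: "\<And>z. norm (D z) = norm (B z)"
    and dense: "closure (range B) = UNIV"
  obtains J where "linear J" "\<And>x. norm (J x) = norm x" "\<And>z. J (B z) = D z"
proof -
  \<comment> \<open>The choice of the preimage does not matter: equal norms force D to vanish
    wherever B does.\<close>
  define f where "f x = D (SOME z. B z = x)" for x
  have f: "f (B z) = D z" for z
  proof -
    let ?w = "SOME w. B w = B z"
    have "B ?w = B z" by (rule someI) simp
    then have "norm (D (?w - z)) = 0" by (simp add: eq linear_diff[OF B])
    then show ?thesis by (simp add: f_def linear_diff[OF D])
  qed
  have "dist (f x) (f y) = dist x y" if "x \<in> range B" "y \<in> range B" for x y
    using that by (auto simp: f dist_norm eq simp flip: linear_diff[OF B] linear_diff[OF D])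
  then have "uniformly_continuous_on (range B) f"
    unfolding uniformly_continuous_on_def by metis
  then obtain J where uc: "uniformly_continuous_on (closure (range B)) J" and "\<And>x. x \<in> range B \<Longrightarrow> f x = J x"
    using uniformly_continuous_on_extension_on_closure by metis
  then have cont: "continuous_on UNIV J" and JB: "J (B z) = D z" for z
    using uniformly_continuous_imp_continuous[OF uc] dense f by auto
  note lim = continuous_on_tendsto_compose[OF cont]
  \<comment> \<open>One sequence z serves both limits; along such sequences linearity and the norm
    equality pass from B and D to J.\<close>
  have seq: "\<exists>z. (\<lambda>n. B (z n)) \<longlonglongrightarrow> x \<and> (\<lambda>n. D (z n)) \<longlonglongrightarrow> J x" for x
  proof -
    have "x \<in> closure (range B)" using dense by simp
    then obtain u where u: "\<forall>n. u n \<in> range B" "u \<longlonglongrightarrow> x" unfolding closure_sequential by blast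
    then obtain z where "\<And>n. u n = B (z n)" unfolding image_iff by metis
    then have "(\<lambda>n. B (z n)) \<longlonglongrightarrow> x" using u by presburger
    then show ?thesis using lim[of "\<lambda>n. B (z n)" x sequentially] JB by auto
  qed
  have J_eqI: "J x = y" if "(\<lambda>n. B (z n)) \<longlonglongrightarrow> x" "(\<lambda>n. D (z n)) \<longlonglongrightarrow> y" for x y z
    using lim[of "\<lambda>n. B (z n)" x sequentially] that LIMSEQ_unique by (auto simp: JB)
  have "linear J"
  proof (rule linearI)
    fix x y
    obtain z w where "(\<lambda>n. B (z n)) \<longlonglongrightarrow> x" "(\<lambda>n. D (z n)) \<longlonglongrightarrow> J x"
      "(\<lambda>n. B (w n)) \<longlonglongrightarrow> y" "(\<lambda>n. D (w n)) \<longlonglongrightarrow> J y" using seq by metis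
    then show "J (x + y) = J x + J y"
      by (intro J_eqI[of "\<lambda>n. z n + w n"]) (simp_all add: linear_add[OF B] linear_add[OF D] tendsto_add)
  next
    fix c x
    obtain z where "(\<lambda>n. B (z n)) \<longlonglongrightarrow> x" "(\<lambda>n. D (z n)) \<longlonglongrightarrow> J x" using seq by metis
    then show "J (c *\<^sub>R x) = c *\<^sub>R J x"
      by (intro J_eqI[of "\<lambda>n. c *\<^sub>R z n"]) (simp_all add: linear_scale[OF B] linear_scale[OF D] tendsto_scaleR)
  qed
  moreover have "norm (J x) = norm x" for x
  proof -
    obtain z where "(\<lambda>n. B (z n)) \<longlonglongrightarrow> x" "(\<lambda>n. D (z n)) \<longlonglongrightarrow> J x" using seq by metis
    then have "(\<lambda>n. norm (B (z n))) \<longlonglongrightarrow> norm x" "(\<lambda>n. norm (D (z n))) \<longlonglongrightarrow> norm (J x)"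
      by (auto intro: tendsto_norm)
    then show ?thesis unfolding eq using LIMSEQ_unique by blast
  qed
  ultimately show ?thesis using that JB by blast
qed

section \<open>Complex Hilbert spaces\<close>

lemma cinner_add_left: "cinner (x + y) z = cinner x z + cinner (y::'a::complex_hilbert_space) z"
  by (metis cinner_add_right cinner_commute complex_cnj_add)

lemma cinner_scaleC_left: "cinner (c *\<^sub>C x) y = cnj c * cinner x (y::'a::complex_hilbert_space)"
  by (metis cinner_scaleC_right cinner_commute complex_cnj_mult)

text \<open>The complex scalar product is recovered from the real one and multiplication by i, so
  complex identities reduce to real symmetry and the behaviour under i.\<close>

lemma cinner_eq_Complex: "cinner x y = Complex (inner x y) (- inner x (\<i> *\<^sub>C (y::'a::complex_hilbert_space)))"
  by (simp add: complex_eq_iff inner_eq_Re_cinner cinner_scaleC_right)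

lemma linear_scaleC: "linear ((*\<^sub>C) c :: 'a::complex_hilbert_space \<Rightarrow> 'a)"
proof (rule linearI)
  show "c *\<^sub>C r *\<^sub>R x = r *\<^sub>R c *\<^sub>C x" for r and x :: 'a
    by (simp only: scaleC_of_real[symmetric] scaleC_scaleC mult.commute)
qed (rule scaleC_add_right)

lemma i_scaleC_i [simp]: "\<i> *\<^sub>C \<i> *\<^sub>C x = - (x::'a::complex_hilbert_space)"
  using scaleC_of_real[of "-1" x] by (simp add: scaleC_scaleC)

lemma scaleC_Complex: "c *\<^sub>C x = Re c *\<^sub>R x + Im c *\<^sub>R \<i> *\<^sub>C (x::'a::complex_hilbert_space)"
proof -
  have "c *\<^sub>C x = (complex_of_real (Re c) + complex_of_real (Im c) * \<i>) *\<^sub>C x"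
    by (subst (1) complex_eq[of c]) (simp only: mult.commute)
  then show ?thesis by (simp only: scaleC_add_left scaleC_scaleC[symmetric] scaleC_of_real)
qed

lemma scaleC_diff_right: "c *\<^sub>C (x - y) = c *\<^sub>C x - c *\<^sub>C (y::'a::complex_hilbert_space)"
  by (rule linear_diff[OF linear_scaleC])

lemma scaleC_minus_right [simp]: "c *\<^sub>C (- x) = - (c *\<^sub>C (x::'a::complex_hilbert_space))"
  by (rule linear_neg[OF linear_scaleC])

lemma inner_i_i [simp]: "inner (\<i> *\<^sub>C x) (\<i> *\<^sub>C y) = inner x (y::'a::complex_hilbert_space)"
  by (simp add: inner_eq_Re_cinner cinner_scaleC_left cinner_scaleC_right)

lemma inner_i_left: "inner (\<i> *\<^sub>C x) y = - inner x (\<i> *\<^sub>C (y::'a::complex_hilbert_space))"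
  using inner_i_i[of x "\<i> *\<^sub>C y"] by simp

lemma bounded_linear_i: "bounded_linear ((*\<^sub>C) \<i> :: 'a::complex_hilbert_space \<Rightarrow> 'a)"
  by (rule bounded_linear_isometry[OF linear_scaleC]) (simp add: norm_eq_sqrt_inner)

lemma complex_linearI:
  fixes L :: "'a::complex_hilbert_space \<Rightarrow> 'a"
  assumes "linear L" "\<And>x. L (\<i> *\<^sub>C x) = \<i> *\<^sub>C L x"
  shows "L (c *\<^sub>C x) = c *\<^sub>C L x"
  by (simp add: scaleC_Complex[of c] linear_add[OF assms(1)] linear_scale[OF assms(1)] assms(2))

lemma complex_antilinearI:
  fixes L :: "'a::complex_hilbert_space \<Rightarrow> 'a"
  assumes "linear L" "\<And>x. L (\<i> *\<^sub>C x) = - (\<i> *\<^sub>C L x)"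
  shows "L (c *\<^sub>C x) = cnj c *\<^sub>C L x"
  by (simp add: scaleC_Complex[of c] scaleC_Complex[of "cnj c"] linear_add[OF assms(1)] linear_scale[OF assms(1)] assms(2))

lemma cinner_sym_complex_linear:
  fixes L :: "'a::complex_hilbert_space \<Rightarrow> 'a"
  assumes "\<And>x y. inner (L x) y = inner x (L y)" "\<And>x. L (\<i> *\<^sub>C x) = \<i> *\<^sub>C L x"
  shows "cinner (L x) y = cinner x (L y)"
  by (simp add: cinner_eq_Complex assms(1) flip: assms(2))

lemma cinner_sym_antilinear:
  fixes L :: "'a::complex_hilbert_space \<Rightarrow> 'a"
  assumes "\<And>x y. inner (L x) y = inner x (L y)" "\<And>x. L (\<i> *\<^sub>C x) = - (\<i> *\<^sub>C L x)"
  shows "cinner x (L y) = cinner y (L x)"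
proof -
  have "inner x (\<i> *\<^sub>C L y) = - inner (L x) (\<i> *\<^sub>C y)" using assms(2)[of y] by (simp add: assms(1))
  also have "\<dots> = inner y (\<i> *\<^sub>C L x)" by (simp add: inner_commute flip: inner_i_left)
  finally show ?thesis
    by (simp add: cinner_eq_Complex inner_commute[of y] assms(1))
qed

lemma anti_unitary_orthogonal_transformation:
  assumes "anti_unitary J"
  shows "orthogonal_transformation J"
  unfolding orthogonal_transformation_def
proof (intro conjI allI)
  show "linear J"
  proof (rule linearI)
    show "J (x + y) = J x + J y" for x y using assms by (simp add: anti_unitary_def)
    show "J (c *\<^sub>R x) = c *\<^sub>R J x" for c x
      using assms unfolding anti_unitary_def by (metis scaleC_of_real complex_cnj_complex_of_real)
  qed
  show "inner (J x) (J y) = inner x y" for x y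
    using assms unfolding anti_unitary_def inner_eq_Re_cinner by (metis cinner_commute cnj.sel(1))
qed

lemma anti_unitaryI:
  fixes J :: "'a::complex_hilbert_space \<Rightarrow> 'a"
  assumes J: "orthogonal_transformation J" "\<And>x. J (\<i> *\<^sub>C x) = - (\<i> *\<^sub>C J x)" "surj J"
  shows "anti_unitary J"
proof -
  have lin: "linear J" and in_J: "inner (J x) (J y) = inner x y" for x y
    using J unfolding orthogonal_transformation_def by auto
  have "cinner (J x) (J y) = cinner y x" for x y
  proof -
    have "inner (J x) (\<i> *\<^sub>C J y) = - inner x (\<i> *\<^sub>C y)"
      using in_J[of x "\<i> *\<^sub>C y"] by (simp add: J(2))
    also have "\<dots> = inner y (\<i> *\<^sub>C x)" by (simp add: inner_commute flip: inner_i_left)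
    finally show ?thesis by (simp add: cinner_eq_Complex in_J inner_commute)
  qed
  then show ?thesis unfolding anti_unitary_def
    using linear_add[OF lin] complex_antilinearI[OF lin J(2)] J(3) by blast
qed

section \<open>The bounded operators attached to a standard subspace\<close>

locale standard =
  fixes V :: "'a::complex_hilbert_space set"
  assumes standard: "standard_subspace V"
begin

definition P where "P = orth_proj V"
text \<open>This is P conjugated by the real orthogonal map i, whose inverse is -i.\<close>

definition Q where "Q x = - (\<i> *\<^sub>C P (\<i> *\<^sub>C x))"
definition D where "D x = P x - Q x"
definition R where "R x = P x + Q x"
definition C where "C x = 2 *\<^sub>R x - R x"

lemma V: "subspace V" "closed V"
  using standard unfolding standard_subspace_def by auto

lemma dense_V: "closure {x + \<i> *\<^sub>C y | x y. x \<in> V \<and> y \<in> V} = UNIV"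
  using standard unfolding standard_subspace_def by auto

lemma V_inter: "x \<in> V \<Longrightarrow> \<i> *\<^sub>C x \<in> V \<Longrightarrow> x = 0"
proof -
  assume "x \<in> V" "\<i> *\<^sub>C x \<in> V"
  then have "\<i> *\<^sub>C x \<in> V \<inter> (*\<^sub>C) \<i> ` V" by blast
  then have "\<i> *\<^sub>C x = 0" using standard unfolding standard_subspace_def by simp
  then have "- x = \<i> *\<^sub>C 0" by (metis i_scaleC_i)
  then show "x = 0" by (simp add: linear_0[OF linear_scaleC])
qed

lemma P_in: "P x \<in> V" and P_id: "v \<in> V \<Longrightarrow> P v = v" and lin_P: "linear P"
  and P_sym: "inner (P x) y = inner x (P y)"
  unfolding P_def using orth_proj_in[OF V] orth_proj_idem[OF V] linear_orth_proj[OF V] orth_proj_sym[OF V] by auto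

lemma P_P [simp]: "P (P x) = P x" by (rule P_id[OF P_in])

text \<open>Multiplication by i interchanges P and Q. Hence the difference D is antilinear, while
  the sum R, and with it C, is complex linear.\<close>

lemma P_i: "P (\<i> *\<^sub>C x) = \<i> *\<^sub>C Q x" by (simp add: Q_def)

lemma Q_i: "Q (\<i> *\<^sub>C x) = \<i> *\<^sub>C P x" by (simp add: Q_def linear_neg[OF lin_P])

lemma lin_Q: "linear Q"
  by (rule linearI) (simp_all add: Q_def scaleC_add_right linear_add[OF lin_P]
      linear_scale[OF lin_P] linear_scale[OF linear_scaleC])

lemma Q_Q [simp]: "Q (Q x) = Q x" by (simp add: Q_def linear_neg[OF lin_P])

lemma Q_id: "v \<in> V \<Longrightarrow> Q (\<i> *\<^sub>C v) = \<i> *\<^sub>C v" by (simp add: Q_i P_id)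

lemma Q_eq: "Q x = \<i> *\<^sub>C (- P (\<i> *\<^sub>C x))" by (simp add: Q_def)

lemma neg_P_in: "- P x \<in> V" using P_in V subspace_neg by blast

lemma Q_sym: "inner (Q x) y = inner x (Q y)"
  by (simp add: Q_def inner_i_left P_sym)

lemmas lin_PQ = linear_add[OF lin_P] linear_diff[OF lin_P] linear_scale[OF lin_P] linear_neg[OF lin_P]
  linear_add[OF lin_Q] linear_diff[OF lin_Q] linear_scale[OF lin_Q] linear_neg[OF lin_Q]

lemmas ops = D_def R_def C_def

lemma lin_D: "linear D" by (rule linearI) (simp_all add: ops lin_PQ algebra_simps)
lemma lin_R: "linear R" by (rule linearI) (simp_all add: ops lin_PQ algebra_simps)
lemma lin_C: "linear C" by (rule linearI) (simp_all add: ops lin_PQ algebra_simps)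

lemma D_i: "D (\<i> *\<^sub>C x) = - (\<i> *\<^sub>C D x)"
  by (simp add: ops P_i Q_i scaleC_diff_right)
lemma R_i: "R (\<i> *\<^sub>C x) = \<i> *\<^sub>C R x"
  by (simp add: ops P_i Q_i scaleC_add_right)
lemma C_i: "C (\<i> *\<^sub>C x) = \<i> *\<^sub>C C x"
  by (simp add: C_def R_i scaleC_diff_right linear_scale[OF linear_scaleC])

lemma D_sym: "inner (D x) y = inner x (D y)"
  by (simp add: ops inner_diff_left inner_diff_right P_sym Q_sym)
lemma R_sym: "inner (R x) y = inner x (R y)"
  by (simp add: ops inner_add_left inner_add_right P_sym Q_sym)
lemma C_sym: "inner (C x) y = inner x (C y)"
  by (simp add: C_def inner_diff_left inner_diff_right R_sym)

text \<open>Both sides expand to P + Q - PQ - QP because P and Q are idempotent.\<close>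

lemma D_D: "D (D x) = R (C x)"
  by (simp add: ops lin_PQ scaleR_2 algebra_simps)
lemma C_R: "C (R x) = R (C x)"
  by (simp add: C_def linear_diff[OF lin_R] linear_scale[OF lin_R])
lemma R_add_C: "R x + C x = 2 *\<^sub>R x" by (simp add: C_def)

lemma inner_P_self: "inner x (P x) = (norm (P x))\<^sup>2" by (metis P_P P_sym power2_norm_eq_inner)
lemma inner_Q_self: "inner x (Q x) = (norm (Q x))\<^sup>2" by (metis Q_Q Q_sym power2_norm_eq_inner)

text \<open>If P x = Q x, this vector lies in V and in iV, so it is 0. Then x is orthogonal to V +
  iV, which is dense.\<close>

lemma D_eq_0: "D x = 0 \<Longrightarrow> x = 0"
proof -
  assume "D x = 0"
  then have eq: "P x = \<i> *\<^sub>C (- P (\<i> *\<^sub>C x))" unfolding D_def Q_eq by (simp only: right_minus_eq)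
  have "- P (\<i> *\<^sub>C x) = 0"
    by (rule V_inter) (use neg_P_in P_in[of x] eq in auto)
  then have Pi: "P (\<i> *\<^sub>C x) = 0" and P: "P x = 0"
    using eq linear_0[OF linear_scaleC, of \<i>] by auto
  show "x = 0"
  proof (rule orthogonal_to_dense[OF dense_V])
    fix u assume "u \<in> {x + \<i> *\<^sub>C y | x y. x \<in> V \<and> y \<in> V}"
    then obtain v w where u: "u = v + \<i> *\<^sub>C w" and vw: "v \<in> V" "w \<in> V" by blast
    have "inner x v = 0" using P_sym[of x v] P P_id[OF vw(1)] by simp
    moreover have "inner x (\<i> *\<^sub>C w) = 0"
      using P_sym[of "\<i> *\<^sub>C x" w] Pi P_id[OF vw(2)] by (simp add: inner_i_left)
    ultimately show "inner x u = 0" by (simp add: u inner_add_right)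
  qed
qed

lemma R_eq_0: "R x = 0 \<Longrightarrow> x = 0"
proof -
  assume "R x = 0"
  then have "inner x (P x) + inner x (Q x) = 0" by (metis R_def inner_add_right inner_zero_right)
  then have "P x = 0" "Q x = 0" unfolding inner_P_self inner_Q_self by (simp_all add: sum_power2_eq_zero_iff)
  then show ?thesis using D_eq_0 by (simp add: D_def)
qed

lemma C_eq_0: "C x = 0 \<Longrightarrow> x = 0"
  by (rule D_eq_0, rule D_eq_0) (simp add: D_D linear_0[OF lin_R])

text \<open>For two orthogonal projections (P - Q)^2 + (1 - P - Q)^2 = 1. The bound makes D^2 a
  positive contraction, as the square root construction requires.\<close>

lemma norm_D_le: "norm (D x) \<le> norm x"
proof (rule power2_le_imp_le)
  have "(norm (D x))\<^sup>2 + (norm (x - R x))\<^sup>2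
      = (norm x)\<^sup>2 + 2 * ((norm (P x))\<^sup>2 - inner x (P x)) + 2 * ((norm (Q x))\<^sup>2 - inner x (Q x))"
    unfolding D_def R_def power2_norm_eq_inner
    by (simp add: inner_diff_left inner_diff_right inner_add_left inner_add_right inner_commute)
  then have "(norm (D x))\<^sup>2 + (norm (x - R x))\<^sup>2 = (norm x)\<^sup>2"
    by (simp add: inner_P_self inner_Q_self)
  then show "(norm (D x))\<^sup>2 \<le> (norm x)\<^sup>2" using zero_le_power2[of "norm (x - R x)"] by linarith
qed simp

lemma bounded_D: "bounded_linear D"
  by (rule bounded_linear_intro[where K = 1]) (use lin_D norm_D_le in \<open>auto simp: linear_add linear_scale\<close>)

lemma bounded_R: "bounded_linear R"
proof (rule bounded_linear_intro[where K = 2])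
  fix x
  have "(norm (P x))\<^sup>2 \<le> norm x * norm (P x)" "(norm (Q x))\<^sup>2 \<le> norm x * norm (Q x)"
    by (metis inner_P_self norm_cauchy_schwarz, metis inner_Q_self norm_cauchy_schwarz)
  then have "norm (P x) \<le> norm x" "norm (Q x) \<le> norm x"
    by (auto simp: power2_eq_square mult_le_cancel_right)
  then show "norm (R x) \<le> norm x * 2" unfolding R_def using norm_triangle_ineq[of "P x" "Q x"] by linarith
qed (use lin_R in \<open>auto simp: linear_add linear_scale\<close>)

section \<open>The positive root of D^2 and its commutation relations\<close>

sublocale D_square: positive_contraction "\<lambda>x. D (D x)"
proof (rule positive_contraction.intro)
  show "linear (\<lambda>x. D (D x))" using linear_compose[OF lin_D lin_D] by (simp add: o_def)
  show "inner (D (D x)) y = inner x (D (D y))" for x y by (simp add: D_sym)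
  show "(norm (D (D x)))\<^sup>2 \<le> inner x (D (D x))" for x
  proof -
    have "(norm (D (D x)))\<^sup>2 \<le> (norm (D x))\<^sup>2" using norm_D_le by (simp add: power_mono)
    also have "\<dots> = inner x (D (D x))" by (simp only: power2_norm_eq_inner D_sym)
    finally show ?thesis .
  qed
qed

definition B where "B = op_sqrt (\<lambda>x. D (D x))"

lemmas lin_B = D_square.op_sqrt_linear[folded B_def]
  and B_sym = D_square.op_sqrt_sym[folded B_def]
  and B_nonneg = D_square.op_sqrt_nonneg[folded B_def]
  and B_B = D_square.op_sqrt_square[folded B_def]
  and B_commute = D_square.op_sqrt_commute[folded B_def]
  and B_unique = D_square.op_sqrt_unique[folded B_def]
  and bounded_B = D_square.op_sqrt_bounded[folded B_def]

lemma B_i: "B (\<i> *\<^sub>C x) = \<i> *\<^sub>C B x"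
  by (rule B_commute[symmetric, OF bounded_linear_i]) (simp add: D_i linear_neg[OF lin_D])

lemma D_B: "D (B x) = B (D x)"
  by (rule B_commute[OF bounded_D]) simp

lemma R_B: "R (B x) = B (R x)"
  by (rule B_commute[OF bounded_R]) (simp add: D_D C_R)

lemma C_B: "C (B x) = B (C x)"
  by (simp add: C_def R_B linear_diff[OF lin_B] linear_scale[OF lin_B])

lemma B_B': "B (B x) = R (C x)" by (simp add: B_B D_D)

lemma B_eq_0: "B x = 0 \<Longrightarrow> x = 0"
  by (rule D_eq_0, rule D_eq_0) (simp add: linear_0[OF lin_B] flip: B_B)

lemma norm_D_eq_norm_B: "norm (D x) = norm (B x)"
proof -
  have "inner (D x) (D x) = inner (B x) (B x)" by (simp add: D_sym B_sym B_B)
  then show ?thesis by (simp add: norm_eq_sqrt_inner)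
qed

lemma dense_B: "closure (range B) = UNIV" by (rule symmetric_dense_range[OF lin_B B_sym B_eq_0])
lemma dense_D: "closure (range D) = UNIV" by (rule symmetric_dense_range[OF lin_D D_sym D_eq_0])
lemma dense_R: "closure (range R) = UNIV" by (rule symmetric_dense_range[OF lin_R R_sym R_eq_0])

section \<open>The conjugation J as isometric factor of D\<close>

definition J where "J = (SOME J. linear J \<and> (\<forall>x. norm (J x) = norm x) \<and> (\<forall>x. J (B x) = D x))"

lemma J_spec: "linear J \<and> (\<forall>x. norm (J x) = norm x) \<and> (\<forall>x. J (B x) = D x)"
proof -
  obtain K where "linear K" "\<And>x. norm (K x) = norm x" "\<And>x. K (B x) = D x"
    using isometric_extension[OF lin_B lin_D norm_D_eq_norm_B dense_B] by blast
  then have "\<exists>J. linear J \<and> (\<forall>x. norm (J x) = norm x) \<and> (\<forall>x. J (B x) = D x)" by blast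
  then show ?thesis unfolding J_def by (rule someI_ex)
qed

lemma lin_J: "linear J" and norm_J: "norm (J x) = norm x" and J_B: "J (B x) = D x"
  using J_spec by auto

lemma orthogonal_J: "orthogonal_transformation J"
  unfolding orthogonal_transformation using lin_J norm_J by blast

lemma cont_J: "bounded_linear F \<Longrightarrow> continuous_on UNIV (\<lambda>x. J (F x))"
  using bounded_linear_compose[OF bounded_linear_isometry[OF lin_J norm_J]] linear_continuous_on by blast

text \<open>On the range of B: J D B = J B D = D^2 = B^2. Together with J B = D this makes J an
  involution.\<close>

lemma J_D: "J (D x) = B x"
proof (rule continuous_eq_on_dense[OF cont_J[OF bounded_D] linear_continuous_on[OF bounded_B] dense_B])
  fix x assume "x \<in> range B"
  then show "J (D x) = B x" by (auto simp: D_B J_B B_B)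
qed

lemma J_J: "J (J x) = x"
proof (rule continuous_eq_on_dense[OF cont_J _ dense_B])
  show "bounded_linear J" by (rule bounded_linear_isometry[OF lin_J norm_J])
  fix x assume "x \<in> range B"
  then show "J (J x) = x" by (auto simp: J_B J_D)
qed simp

lemma B_J: "B (J x) = D x"
proof -
  have "B (J x) = J (B x)"
  proof (rule continuous_eq_on_dense[OF _ cont_J[OF bounded_B] dense_B])
    show "continuous_on UNIV (\<lambda>x. B (J x))"
      using bounded_linear_compose[OF bounded_B bounded_linear_isometry[OF lin_J norm_J]] linear_continuous_on by blast
    fix x assume "x \<in> range B"
    then show "B (J x) = J (B x)" by (auto simp: J_B simp flip: D_B)
  qed
  then show ?thesis by (simp add: J_B)
qed

lemma D_J: "D (J x) = B x"
  using B_J[of "J x"] by (simp add: J_J)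

lemma J_i: "J (\<i> *\<^sub>C x) = - (\<i> *\<^sub>C J x)"
proof (rule continuous_eq_on_dense[OF cont_J[OF bounded_linear_i] _ dense_B])
  have "bounded_linear (\<lambda>x. - (\<i> *\<^sub>C J x))"
    by (intro bounded_linear_minus bounded_linear_compose[OF bounded_linear_i]
        bounded_linear_isometry[OF lin_J norm_J])
  then show "continuous_on UNIV (\<lambda>x. - (\<i> *\<^sub>C J x))" by (rule linear_continuous_on)
  fix x assume "x \<in> range B"
  then show "J (\<i> *\<^sub>C x) = - (\<i> *\<^sub>C J x)" by (auto simp: J_B D_i simp flip: B_i)
qed

lemma anti_unitary_J: "anti_unitary J"
  by (rule anti_unitaryI[OF orthogonal_J J_i]) (metis J_J surjI)

text \<open>D and C agree on V and are negatives of each other on iV. The graph of the Tomita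
  operator is thus that of the formal quotient of C by the injective D.\<close>

lemma tomita_operator_iff: "(v, t) \<in> tomita_operator V \<longleftrightarrow> D t = C v"
proof -
  have DC: "D (x - \<i> *\<^sub>C y) = C (x + \<i> *\<^sub>C y)" if "x \<in> V" "y \<in> V" for x y
    using P_id[OF that(1)] Q_id[OF that(2)]
    by (simp add: ops lin_PQ scaleR_2)
  show ?thesis
  proof
    assume "(v, t) \<in> tomita_operator V"
    then show "D t = C v" unfolding tomita_operator_def using DC by auto
  next
    assume eq: "D t = C v"
    \<comment> \<open>If t = x - iy and v = x + iy, then x and iy are half of t + v and half of v -
      t. The projections place the candidates in V and iV in advance; twice their sum is D t + R v =
      C v + R v = 2 v.\<close>
    define x where "x = (1/2) *\<^sub>R P (t + v)"
    define y where "y = (1/2) *\<^sub>R (- P (\<i> *\<^sub>C (v - t)))"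
    have xy: "x \<in> V" "y \<in> V" unfolding x_def y_def by (rule subspace_scale[OF V(1)], rule P_in neg_P_in)+
    have "\<i> *\<^sub>C y = (1/2) *\<^sub>R Q (v - t)"
      unfolding y_def by (simp only: linear_scale[OF linear_scaleC] Q_eq)
    then have "x + \<i> *\<^sub>C y = (1/2) *\<^sub>R (P (t + v) + Q (v - t))"
      by (simp only: x_def scaleR_right_distrib)
    also have "P (t + v) + Q (v - t) = 2 *\<^sub>R v"
      using eq by (simp add: ops lin_PQ algebra_simps)
    finally have v: "v = x + \<i> *\<^sub>C y" by simp
    then have "D (t - (x - \<i> *\<^sub>C y)) = 0" using eq DC[OF xy] by (simp add: linear_diff[OF lin_D])
    then have "t = x - \<i> *\<^sub>C y" using D_eq_0 by fastforce
    then show "(v, t) \<in> tomita_operator V" unfolding tomita_operator_def using v xy by blast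
  qed
qed

section \<open>Existence of the polar decomposition\<close>

definition S where "S = {(v, w). B w = C v}"
definition \<Delta> where "\<Delta> = {(R z, C z) | z. True}"

lemma S_iff: "(v, w) \<in> S \<longleftrightarrow> B w = C v" by (simp add: S_def)

lemma S_R_B: "(R z, B z) \<in> S" by (simp add: S_iff B_B' C_R)

lemma S_B_C: "(B z, C z) \<in> S" by (simp add: S_iff C_B)

text \<open>B^2 = R C gives S a second description, R w = B v; injectivity of B cancels the common
  factor.\<close>

lemma S_imp: "(v, w) \<in> S \<Longrightarrow> R w = B v"
proof -
  assume "(v, w) \<in> S"
  then have vw: "B w = C v" by (simp add: S_iff)
  have "B (R w - B v) = R (B w) - B (B v)" by (simp add: linear_diff[OF lin_B] R_B)
  also have "\<dots> = 0" by (simp add: B_B' vw)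
  finally show "R w = B v" using B_eq_0 by fastforce
qed

lemmas cinner_R = cinner_sym_complex_linear[OF R_sym R_i]
  and cinner_C = cinner_sym_complex_linear[OF C_sym C_i]
  and cinner_B = cinner_sym_complex_linear[OF B_sym B_i]

lemma cinner_R_add_C: "cinner (R x) y + cinner (C x) y = 2 * cinner x y"
proof -
  have "2 * cinner x y = cinner (2 *\<^sub>R x) y"
    by (simp add: cinner_scaleC_left flip: scaleC_of_real)
  then show ?thesis by (simp only: cinner_add_left flip: R_add_C)
qed

text \<open>Splitting 2 = R + C and using both descriptions of S turns the two pairings into one and
  the same expression in bounded operators. It yields symmetry of S and, for equal pairs, positivity
  from that of B.\<close>

lemma S_form:
  assumes "(v, w) \<in> S" "(v', w') \<in> S"
  shows "2 * cinner v w' = cinner v (B v') + cinner w (C v')"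
    and "2 * cinner w v' = cinner v (B v') + cinner w (C v')"
proof -
  have w: "R w = B v" "B w = C v" "R w' = B v'" "B w' = C v'"
    using S_imp assms by (auto simp: S_iff)
  have "2 * cinner v w' = cinner v (R w') + cinner (B w) w'"
    by (simp only: w(2) cinner_R flip: cinner_R_add_C)
  then show "2 * cinner v w' = cinner v (B v') + cinner w (C v')" by (simp only: w(3,4) cinner_B)
  have "2 * cinner w v' = cinner (R w) v' + cinner (C w) v'" by (simp only: cinner_R_add_C)
  then show "2 * cinner w v' = cinner v (B v') + cinner w (C v')" by (simp only: w(1) cinner_B cinner_C)
qed

lemma complex_linear_ops [simp]:
  "R (c *\<^sub>C x) = c *\<^sub>C R x" "C (c *\<^sub>C x) = c *\<^sub>C C x" "B (c *\<^sub>C x) = c *\<^sub>C B x"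
  by (rule complex_linearI[OF lin_R R_i] complex_linearI[OF lin_C C_i] complex_linearI[OF lin_B B_i])+

lemma dense_if_R:
  assumes "\<And>z. \<exists>w. (R z, w) \<in> A"
  shows "densely_defined A"
proof -
  have "range R \<subseteq> Domain A" using assms by blast
  then have "closure (range R) \<subseteq> closure (Domain A)" by (rule closure_mono)
  then show ?thesis using dense_R by (auto simp: densely_defined_def)
qed

lemma positive_self_adjointI:
  fixes A :: "'a operator"
  assumes lin: "linear_operator A" and dense: "densely_defined A"
    and sym: "\<And>v w v' w'. (v, w) \<in> A \<Longrightarrow> (v', w') \<in> A \<Longrightarrow> cinner v w' = cinner w v'"
    and adj: "\<And>v w. (v, w) \<in> adjoint_operator A \<Longrightarrow> (v, w) \<in> A"
    and pos: "\<And>v w. (v, w) \<in> A \<Longrightarrow> 0 \<le> inner v w"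
  shows "positive_self_adjoint A"
proof -
  have "adjoint_operator A = A"
  proof (intro subset_antisym subrelI)
    show "(v, w) \<in> adjoint_operator A" if "(v, w) \<in> A" for v w
      using sym[OF that] unfolding adjoint_operator_def by blast
  qed (rule adj)
  moreover have "cinner x y \<in> \<real>\<^sub>\<ge>\<^sub>0" if "(x, y) \<in> A" for x y
  proof -
    have "cinner x y = cnj (cinner x y)" using sym[OF that that] cinner_commute by metis
    then have "Im (cinner x y) = 0" by (metis Reals_cnj_iff complex_is_Real_iff)
    then show ?thesis using pos[OF that] by (simp add: complex_nonneg_Reals_iff inner_eq_Re_cinner)
  qed
  ultimately show ?thesis using lin dense unfolding positive_self_adjoint_def self_adjoint_def by blast
qed

lemma linear_operator_S: "linear_operator S"
  unfolding linear_operator_def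
proof (intro conjI)
  show "single_valued S"
  proof (rule single_valuedI)
    fix v w w' assume "(v, w) \<in> S" "(v, w') \<in> S"
    then have "B (w - w') = 0" by (simp add: S_iff linear_diff[OF lin_B])
    then show "w = w'" using B_eq_0 by fastforce
  qed
qed (auto simp: S_iff linear_add[OF lin_B] linear_add[OF lin_C] linear_0[OF lin_B] linear_0[OF lin_C])

lemma positive_S: "positive_self_adjoint S"
proof (rule positive_self_adjointI[OF linear_operator_S dense_if_R])
  show "\<exists>w. (R z, w) \<in> S" for z using S_R_B by blast
  show "cinner v w' = cinner w v'" if "(v, w) \<in> S" "(v', w') \<in> S" for v w v' w'
    using trans[OF S_form(1)[OF that] S_form(2)[OF that, symmetric]] by simp
  show "0 \<le> inner v w" if "(v, w) \<in> S" for v w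
  proof -
    have "2 * cinner v w = cinner v (B v) + cinner w (B w)"
      using S_form(1)[OF that that] that by (simp add: S_iff)
    then have "Re (2 * cinner v w) = inner v (B v) + inner w (B w)" by (simp add: inner_eq_Re_cinner)
    then show ?thesis using B_nonneg[of v] B_nonneg[of w] by (simp add: inner_eq_Re_cinner)
  qed
  show "(y, z) \<in> S" if "(y, z) \<in> adjoint_operator S" for y z
  proof -
    \<comment> \<open>Testing against the pairs (R x, B x) alone already gives R z = B y; applying R
      to B z - C y then yields 0, and R is injective.\<close>
    have "cinner y (B x) = cinner z (R x)" for x
      using that S_R_B[of x] unfolding adjoint_operator_def by blast
    then have "inner (B y) x = inner (R z) x" for x
      unfolding B_sym R_sym by (simp add: inner_eq_Re_cinner)
    then have "R z = B y" by (metis inner_commute vector_eq_rdot)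
    have "R (B z - C y) = B (R z) - C (R y)"
      by (simp add: linear_diff[OF lin_R] R_B C_R)
    also have "\<dots> = 0" by (simp add: \<open>R z = B y\<close> B_B' C_R)
    finally show ?thesis using R_eq_0 by (fastforce simp: S_iff)
  qed
qed

lemma \<Delta>_iff: "(v, w) \<in> \<Delta> \<longleftrightarrow> R w = C v"
proof
  assume "R w = C v"
  \<comment> \<open>If v = R z and w = C z, then R + C = 2 forces z to be half of v + w.\<close>
  then have "(v, w) = (R ((1/2) *\<^sub>R (v + w)), C ((1/2) *\<^sub>R (v + w)))"
    using R_add_C[of v] R_add_C[of w]
    by (simp add: linear_scale[OF lin_R] linear_scale[OF lin_C] linear_add[OF lin_R] linear_add[OF lin_C]
        add.commute del: scaleR_right_distrib)
  then show "(v, w) \<in> \<Delta>" unfolding \<Delta>_def by blast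
qed (auto simp: \<Delta>_def C_R)

lemma S_O_S: "S O S = \<Delta>"
proof (intro subset_antisym subrelI)
  fix v w assume "(v, w) \<in> S O S"
  then obtain u where "(v, u) \<in> S" "(u, w) \<in> S" by blast
  then show "(v, w) \<in> \<Delta>" using S_imp[of u w] by (simp add: \<Delta>_iff S_iff)
next
  fix v w assume "(v, w) \<in> \<Delta>"
  then show "(v, w) \<in> S O S" unfolding \<Delta>_def using S_R_B S_B_C by blast
qed

lemma strictly_positive_\<Delta>: "strictly_positive_self_adjoint \<Delta>"
  unfolding strictly_positive_self_adjoint_def
proof (intro conjI allI impI)
  show "x = 0" if "(x, 0) \<in> \<Delta>" for x
    using that C_eq_0 by (simp add: \<Delta>_iff linear_0[OF lin_R])
  have "linear_operator \<Delta>"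
    unfolding linear_operator_def
  proof (intro conjI)
    show "single_valued \<Delta>"
    proof (rule single_valuedI)
      fix v w w' assume "(v, w) \<in> \<Delta>" "(v, w') \<in> \<Delta>"
      then have "R (w - w') = 0" by (simp add: \<Delta>_iff linear_diff[OF lin_R])
      then show "w = w'" using R_eq_0 by fastforce
    qed
  qed (auto simp: \<Delta>_iff linear_add[OF lin_R] linear_add[OF lin_C] linear_0[OF lin_R] linear_0[OF lin_C])
  then show "positive_self_adjoint \<Delta>"
  proof (rule positive_self_adjointI[OF _ dense_if_R])
    show "\<exists>w. (R z, w) \<in> \<Delta>" for z unfolding \<Delta>_def by blast
    show "cinner v w' = cinner w v'" if "(v, w) \<in> \<Delta>" "(v', w') \<in> \<Delta>" for v w v' w'
      using that unfolding \<Delta>_def by (auto simp: cinner_R cinner_C C_R)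
    show "0 \<le> inner v w" if vw: "(v, w) \<in> \<Delta>" for v w
    proof -
      obtain z where z: "v = R z" "w = C z" using vw unfolding \<Delta>_def by blast
      have "inner v w = inner (B z) (B z)" by (simp add: z R_sym B_sym B_B')
      then show ?thesis by simp
    qed
    show "(y, z) \<in> \<Delta>" if "(y, z) \<in> adjoint_operator \<Delta>" for y z
    proof -
      have "cinner y (C x) = cinner z (R x)" for x
        using that unfolding adjoint_operator_def \<Delta>_def by blast
      then have "inner (C y) x = inner (R z) x" for x
        unfolding C_sym R_sym by (simp add: inner_eq_Re_cinner)
      then have "R z = C y" by (metis inner_commute vector_eq_rdot)
      then show ?thesis by (simp add: \<Delta>_iff)
    qed
  qed
qed

lemma tomita_polar_decomposition_J: "tomita_polar_decomposition V J \<Delta>"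
  unfolding tomita_polar_decomposition_def
proof (intro conjI allI exI[of _ S])
  show "tomita_operator V = {(x, J y) | x y. (x, y) \<in> S}"
  proof (intro subset_antisym subrelI)
    fix v t assume "(v, t) \<in> tomita_operator V"
    then have "(v, J t) \<in> S" by (simp add: tomita_operator_iff S_iff B_J)
    then show "(v, t) \<in> {(x, J y) | x y. (x, y) \<in> S}" using J_J[of t] by force
  next
    fix v t assume "(v, t) \<in> {(x, J y) | x y. (x, y) \<in> S}"
    then show "(v, t) \<in> tomita_operator V" by (auto simp: tomita_operator_iff S_iff D_J)
  qed
qed (simp_all add: anti_unitary_J J_J strictly_positive_\<Delta> is_sqrt_operator_def positive_S S_O_S)

section \<open>Uniqueness of the modular conjugation\<close>

lemmas cinner_D = cinner_sym_antilinear[OF D_sym D_i]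

text \<open>For any polar decomposition \<open>T = J' S'\<close> the operator \<open>J' D\<close> equals \<open>S' R\<close>, and \<open>S'\<close>
  maps \<open>J' D x\<close> to \<open>C x\<close>. As \<open>R + C = 2\<close>, positivity of \<open>S'\<close> makes \<open>J' D\<close> a positive root of \<open>D\<^sup>2\<close>.\<close>

lemma polar_decomposition_unique:
  assumes "tomita_polar_decomposition V J' \<Delta>'"
  shows "J' = J"
proof -
  obtain S' where J': "anti_unitary J'" "\<And>x. J' (J' x) = x"
    and S': "positive_self_adjoint S'" and T: "tomita_operator V = {(x, J' y) | x y. (x, y) \<in> S'}"
    using assms unfolding tomita_polar_decomposition_def is_sqrt_operator_def by blast
  have adj: "adjoint_operator S' = S'" and pos: "\<And>v w. (v, w) \<in> S' \<Longrightarrow> cinner v w \<in> \<real>\<^sub>\<ge>\<^sub>0"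
    using S' unfolding positive_self_adjoint_def self_adjoint_def by auto
  have sym: "inner v w' = inner w v'" if "(v, w) \<in> S'" "(v', w') \<in> S'" for v w v' w'
  proof -
    have "(v, w) \<in> adjoint_operator S'" using that(1) by (simp only: adj)
    then show ?thesis using that(2) unfolding adjoint_operator_def inner_eq_Re_cinner by fastforce
  qed
  have T_iff: "(v, w) \<in> S' \<longleftrightarrow> D (J' w) = C v" for v w
    unfolding tomita_operator_iff[symmetric] T using J'(2) by (auto) metis
  have orth: "orthogonal_transformation J'" using J'(1) by (rule anti_unitary_orthogonal_transformation)
  then have lin: "linear J'" and isom: "\<And>x y. inner (J' x) (J' y) = inner x y"
    by (auto simp: orthogonal_transformation_def)
  define L where "L x = J' (D x)" for x
  have RL: "(R x, L x) \<in> S'" for x by (simp add: T_iff L_def J'(2) D_D C_R)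
  \<comment> \<open>Membership comes from self-adjointness of \<open>S'\<close>: antiunitarity of
    \<open>J'\<close> swaps the arguments of the scalar product, and the antilinear symmetry of D
    swaps them back.\<close>
  have LC: "(L x, C x) \<in> S'" for x
  proof -
    have "cinner (L x) w = cinner (C x) v" if "(v, w) \<in> S'" for v w
    proof -
      have "cinner (L x) w = cinner (J' (D x)) (J' (J' w))" by (simp add: L_def J'(2))
      also have "\<dots> = cinner (J' w) (D x)" using J'(1) unfolding anti_unitary_def by blast
      also have "\<dots> = cinner x (D (J' w))" by (rule cinner_D)
      also have "\<dots> = cinner (C x) v" using that by (simp add: T_iff cinner_C)
      finally show ?thesis .
    qed
    then have "(L x, C x) \<in> adjoint_operator S'" unfolding adjoint_operator_def by auto
    then show ?thesis by (simp only: adj)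
  qed
  have two: "inner (R x) y + inner (C x) y = 2 * inner x y" for x y
    by (simp add: R_add_C flip: inner_add_left)
  have lin_L: "linear L" unfolding L_def[abs_def] using linear_compose[OF lin_D lin] by (simp add: o_def)
  \<comment> \<open>R + C = 2 splits twice the pairing of x with L y into those of R x and C x with
    L y. Symmetry of \<open>S'\<close> on the pairs (R x, L x), respectively (L x, C x), moves L
    across each summand.\<close>
  have L_sym: "inner (L x) y = inner x (L y)" for x y
    using two[of x "L y"] two[of y "L x"] sym[OF RL[of x] RL[of y]] sym[OF LC[of x] LC[of y]]
      sym[OF LC[of y] RL[of x]]
    by (simp add: inner_commute)
  have L_pos: "0 \<le> inner x (L x)" for x
  proof -
    have "0 \<le> inner (R x) (L x)" "0 \<le> inner (L x) (C x)"
      using pos[OF RL[of x]] pos[OF LC[of x]] by (auto simp: complex_nonneg_Reals_iff inner_eq_Re_cinner)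
    then show ?thesis using two[of x "L x"] by (simp add: inner_commute)
  qed
  have L_L: "L (L x) = D (D x)" for x
  proof -
    have "inner (L (L x)) y = inner (D (D x)) y" for y
    proof -
      have "inner (L (L x)) y = inner (L x) (L y)" by (rule L_sym)
      also have "\<dots> = inner (D x) (D y)" by (simp only: L_def isom)
      finally show ?thesis by (simp only: D_sym)
    qed
    then show ?thesis by (metis inner_commute vector_eq_rdot)
  qed
  have "J' (D x) = J (D x)" for x
    using B_unique[OF lin_L L_sym L_pos L_L] by (simp add: L_def J_D)
  then have "J' x = J x" for x
    using continuous_eq_on_dense[OF _ _ dense_D, of J' J] lin lin_J orth orthogonal_J
      bounded_linear_isometry linear_continuous_on unfolding orthogonal_transformation by blast
  then show ?thesis by blast
qed

lemma modular_conjugation_eq: "modular_conjugation V = J"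
  unfolding modular_conjugation_def
  using tomita_polar_decomposition_J polar_decomposition_unique by (intro the_equality) blast+

section \<open>Maximality\<close>

text \<open>The Tomita operator fixes each x in V, so S sends x to J x and positivity of S is the
  required inequality.\<close>

lemma reflection_positive_V: "reflection_positive V J"
  unfolding reflection_positive_def
proof (intro conjI allI ballI)
  fix x assume x: "x \<in> V"
  have "(x, J x) \<in> S"
  proof -
    have "C x = D x" using P_id[OF x] by (simp add: ops scaleR_2)
    then show ?thesis by (simp add: S_iff B_J)
  qed
  then have "cinner x (J x) \<in> \<real>\<^sub>\<ge>\<^sub>0" using positive_S unfolding positive_self_adjoint_def by blast
  then show "0 \<le> inner x (J x)" by (simp add: complex_nonneg_Reals_iff inner_eq_Re_cinner)
qed (use V orthogonal_J J_J in auto)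

lemma fixed_point_orthogonal_V:
  assumes h: "J h = h" and orth: "\<And>v. v \<in> V \<Longrightarrow> inner h v = 0"
  shows "h = 0"
proof -
  have "inner (P h) (P h) = 0" using orth[OF P_in, of h] by (simp add: P_sym)
  then have P: "P h = 0" by simp
  have "B h = D h" using J_B[of h] D_J[of h] h by simp
  then have "0 \<le> inner h (D h)" using B_nonneg by metis
  then have "(norm (Q h))\<^sup>2 \<le> 0" using P by (simp add: D_def inner_Q_self)
  then have "Q h = 0" by simp
  then show ?thesis using P D_eq_0 by (simp add: D_def)
qed

text \<open>Reflection positivity bounds the norm of v by that of v + J v, so the image of V under
  \<open>f\<close> is complete and h can be projected onto it. The remainder is fixed by J, hence
  pairs equally with v and J v; being orthogonal to their sum, it is orthogonal to V.\<close>

lemma fixed_point_decomposition: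
  assumes h: "J h = h"
  shows "\<exists>v\<in>V. h = v + J v"
proof -
  define f where "f v = v + J v" for v
  have f: "bounded_linear f"
    unfolding f_def by (intro bounded_linear_add bounded_linear_ident bounded_linear_isometry[OF lin_J norm_J])
  have sub: "subspace (f ` V)" by (rule linear_subspace_image[OF bounded_linear.linear[OF f] V(1)])
  have "norm v \<le> norm (f v)" if "v \<in> V" for v
  proof (rule power2_le_imp_le)
    have "0 \<le> inner v (J v)" using reflection_positive_V that unfolding reflection_positive_def by blast
    then show "(norm v)\<^sup>2 \<le> (norm (f v))\<^sup>2"
      by (simp add: f_def power2_norm_eq_inner inner_add_left inner_add_right inner_commute)
  qed simp
  then have "complete (f ` V)"
    using V by (intro complete_isometric_image[of 1, OF _ V(1) f]) (auto simp: complete_eq_closed)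
  then have cl: "closed (f ` V)" by (simp add: complete_eq_closed)
  obtain p where p: "p \<in> f ` V" "\<And>k. k \<in> f ` V \<Longrightarrow> inner (h - p) k = 0"
    using orthogonal_projection_exists[OF sub cl] by blast
  have J_hp: "J (h - p) = h - p"
    using p(1) h by (auto simp: f_def linear_diff[OF lin_J] linear_add[OF lin_J] J_J add.commute)
  have "h - p = 0"
  proof (rule fixed_point_orthogonal_V[OF J_hp])
    fix v assume "v \<in> V"
    then have "0 = inner (h - p) v + inner (h - p) (J v)"
      using p(2)[of "f v"] by (simp add: f_def inner_add_right)
    also have "inner (h - p) (J v) = inner (J (h - p)) (J v)" by (simp only: J_hp)
    also have "\<dots> = inner (h - p) v" using orthogonal_J unfolding orthogonal_transformation_def by blast
    finally show "inner (h - p) v = 0" by simp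
  qed
  then show ?thesis using p(1) by (auto simp: f_def)
qed

lemma maximal_V: "maximal_reflection_positive V J"
  unfolding maximal_reflection_positive_def
proof (intro conjI allI impI iffI)
  show "reflection_positive V J" by (rule reflection_positive_V)
  fix E assume E: "subspace E \<and> closed E \<and> V \<subseteq> E"
  show "reflection_positive E J" if "E = V" using that reflection_positive_V by simp
  assume rp: "reflection_positive E J"
  have "x \<in> V" if x: "x \<in> E" for x
  proof -
    have "J (x + J x) = x + J x" by (simp add: linear_add[OF lin_J] J_J add.commute)
    then obtain v where v: "v \<in> V" "x + J x = v + J v" using fixed_point_decomposition by blast
    define y where "y = x - v"
    have "y \<in> E" unfolding y_def using E x v subspace_diff by blast
    then have "0 \<le> inner y (J y)" using rp unfolding reflection_positive_def by blast
    moreover have "J y = - y" using v(2) by (simp add: y_def linear_diff[OF lin_J] algebra_simps)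
    ultimately have "y = 0" using inner_ge_zero[of y] by simp
    then show ?thesis using v by (simp add: y_def)
  qed
  then show "E = V" using E by blast
qed

end

theorem proposition6p17:
  fixes V :: "'a::complex_hilbert_space set"
  assumes "standard_subspace V"
  shows "maximal_reflection_positive V (modular_conjugation V)"
proof -
  interpret standard V by unfold_locales (rule assms)
  show ?thesis using maximal_V by (simp only: modular_conjugation_eq)
qed

end
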